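(* For $m\ge2$, let $Q_{4m}=\langle a,b\mid a^{2m}=e,\ b^2=a^m,\ b^{-1}ab=a^{-1}\rangle$ be the generalized quaternion group of order $4m$. In the directed Cayley graph $\Gamma(Q_{4m},\{a,b,b^{-1}\})$ the Lin--Lu--Yau Ricci curvatures of the arcs $(e,a)$ and $(e,b)$ are $$\kappa(e,a)=\begin{cases}0,& m=2,\\ -\tfrac23,& m=3,\\ -\tfrac43,& m\ge4,\end{cases}\qquad \kappa(e,b)=\begin{cases}\tfrac23,& m=2,\\ \tfrac13,& m=3,\\ 0,& m\ge4.\end{cases}$$
   Context: For a group $G$ with identity $e$ and a finite set $S\subseteq G\setminus\{e\}$, the directed Cayley graph $\Gamma(G,S)$ has vertex set $G$ and arcs $(g,gs)$ for $g\in G$, $s\in S$. In a simple directed graph $(V,\mathcal A)$, $N^{\rm out}(x)=\{v\in V:(x,v)\in\mathcal A\}$, $d^{\rm out}_x=|N^{\rm out}(x)|$, and $d(x,y)$ is the length of a shortest directed path from $x$ to $y$. For $\alpha\in[0,1]$, the $\alpha$-lazy random walk measure at $x$ is $\mu^\alpha_x(x)=\alpha$, $\mu^\alpha_x(v)=\frac{1-\alpha}{d^{\rm out}_x}$ if $(x,v)\in\mathcal A$, and $\mu_x^\alpha(v)=0$ otherwise. For probability measures $\mu,\nu$ on $V$, $W(\mu,\nu)=\inf_A\sum_{u,v\in V}A(u,v)d(u,v)$, the infimum over couplings $A:V\times V\to[0,1]$ with $\sum_{v}A(u,v)=\mu(u)$ for all $u$ and $\sum_uA(u,v)=\nu(v)$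 for all $v$. For distinct $x,y$, $\kappa_\alpha(x,y)=1-\frac{W(\mu_x^\alpha,\mu_y^\alpha)}{d(x,y)}$, and the Lin--Lu--Yau Ricci curvature is $\kappa(x,y)=\lim_{\alpha\to1^-}\frac{\kappa_\alpha(x,y)}{1-\alpha}$. *)

theory Defs
  imports
    "HOL-Analysis.Analysis"
    "HOL-Algebra.Group"
    "Graph_Theory.Pair_Digraph"
begin

section \<open>Groups given by generators and relations\<close>

text \<open>A word is a list of letters; \<open>(x, True)\<close> stands for the generator \<open>x\<close> and
  \<open>(x, False)\<close> for its formal inverse. The group presented by a set \<open>R\<close> of relations \<open>u = v\<close>
  is the quotient of the monoid of words by the least congruence that contains \<open>R\<close> and
  cancels adjacent inverse letters. The generating set is the whole type \<open>'g\<close>.\<close>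

type_synonym 'g word = "('g \<times> bool) list"

inductive_set word_cong :: "'g word rel \<Rightarrow> 'g word rel" for R :: "'g word rel" where
  refl: "(u, u) \<in> word_cong R"
| sym: "(u, v) \<in> word_cong R \<Longrightarrow> (v, u) \<in> word_cong R"
| trans: "(u, v) \<in> word_cong R \<Longrightarrow> (v, w) \<in> word_cong R \<Longrightarrow> (u, w) \<in> word_cong R"
| append: "(u, u') \<in> word_cong R \<Longrightarrow> (v, v') \<in> word_cong R \<Longrightarrow> (u @ v, u' @ v') \<in> word_cong R"
| cancel: "([(x, s), (x, \<not> s)], []) \<in> word_cong R"
| relation: "(u, v) \<in> R \<Longrightarrow> (u, v) \<in> word_cong R"

definition word_class :: "'g word rel \<Rightarrow> 'g word \<Rightarrow> 'g word set" where
  "word_class R w = word_cong R `` {w}"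

definition presented_group :: "'g word rel \<Rightarrow> 'g word set monoid" where
  "presented_group R =
     \<lparr>carrier = UNIV // word_cong R,
      mult = (\<lambda>X Y. \<Union>u\<in>X. \<Union>v\<in>Y. word_class R (u @ v)),
      one = word_class R []\<rparr>"

lemma equiv_word_cong: "equiv UNIV (word_cong R)"
proof (rule equivI)
  show "refl (word_cong R)"
    by (rule reflI) (rule word_cong.refl)
  show "Relation.sym (word_cong R)"
    by (rule symI) (rule word_cong.sym)
  show "Relation.trans (word_cong R)"
    by (rule transI) (rule word_cong.trans)
qed simp

lemma word_class_eq_iff: "word_class R u = word_class R v \<longleftrightarrow> (u, v) \<in> word_cong R"
  unfolding word_class_def by (simp add: eq_equiv_class_iff[OF equiv_word_cong])

lemma carrier_presented_group: "carrier (presented_group R) = range (word_class R)"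
  by (auto simp: presented_group_def quotient_def word_class_def)

lemma one_presented_group: "\<one>\<^bsub>presented_group R\<^esub> = word_class R []"
  by (simp add: presented_group_def)

lemma mult_presented_group:
  "word_class R u \<otimes>\<^bsub>presented_group R\<^esub> word_class R v = word_class R (u @ v)"
proof -
  have "word_class R (u' @ v') = word_class R (u @ v)"
    if "u' \<in> word_class R u" "v' \<in> word_class R v" for u' v'
    unfolding word_class_eq_iff using that
    by (intro word_cong.append word_cong.sym[of u u'] word_cong.sym[of v v'])
       (simp_all add: word_class_def)
  then have "(\<Union>u'\<in>word_class R u. \<Union>v'\<in>word_class R v. word_class R (u' @ v'))
      = (\<Union>u'\<in>word_class R u. \<Union>v'\<in>word_class R v. word_class R (u @ v))"
    by (intro SUP_cong HOL.refl)
  moreover have "u \<in> word_class R u" "v \<in> word_class R v"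
    by (simp_all add: word_class_def word_cong.refl)
  ultimately show ?thesis
    unfolding presented_group_def monoid.simps partial_object.simps by blast
qed

lemma word_inverse_left:
  "(map (\<lambda>(x, s). (x, \<not> s)) (rev w) @ w, []) \<in> word_cong R"
proof (induction w)
  case Nil
  show ?case by (simp add: word_cong.refl)
next
  case (Cons l w)
  obtain x s where l: "l = (x, s)" by fastforce
  let ?r = "map (\<lambda>(x, s). (x, \<not> s)) (rev w)"
  have "([(x, \<not> s), (x, s)], []) \<in> word_cong R"
    using word_cong.cancel[of x "\<not> s"] by simp
  then have "(?r @ [(x, \<not> s), (x, s)] @ w, ?r @ [] @ w) \<in> word_cong R"
    by (intro word_cong.append word_cong.refl)
  then show ?case
    using word_cong.trans[OF _ Cons.IH] l by simp
qed

lemma group_presented_group: "group (presented_group R)"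
proof (rule groupI)
  fix X assume "X \<in> carrier (presented_group R)"
  then obtain w where "X = word_class R w"
    by (auto simp: carrier_presented_group)
  then have "word_class R (map (\<lambda>(x, s). (x, \<not> s)) (rev w)) \<otimes>\<^bsub>presented_group R\<^esub> X
      = \<one>\<^bsub>presented_group R\<^esub>"
    by (simp add: mult_presented_group one_presented_group word_class_eq_iff word_inverse_left)
  then show "\<exists>Y\<in>carrier (presented_group R).
      Y \<otimes>\<^bsub>presented_group R\<^esub> X = \<one>\<^bsub>presented_group R\<^esub>"
    by (auto simp: carrier_presented_group)
qed (auto simp: carrier_presented_group one_presented_group mult_presented_group)


section \<open>The generalized quaternion group\<close>

datatype quat_gen = A | B

text \<open>The relations \<open>a\<^sup>2\<^sup>m = e\<close>, \<open>b\<^sup>2 = a\<^sup>m\<close> and \<open>b\<^sup>-\<^sup>1 a b = a\<^sup>-\<^sup>1\<close>.\<close>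

definition quat_relations :: "nat \<Rightarrow> quat_gen word rel" where
  "quat_relations m =
     {(replicate (2 * m) (A, True), []),
      (replicate 2 (B, True), replicate m (A, True)),
      ([(B, False), (A, True), (B, True)], [(A, False)])}"

definition quat_group :: "nat \<Rightarrow> quat_gen word set monoid" where
  "quat_group m = presented_group (quat_relations m)"

definition quat_a :: "nat \<Rightarrow> quat_gen word set" where
  "quat_a m = word_class (quat_relations m) [(A, True)]"

definition quat_b :: "nat \<Rightarrow> quat_gen word set" where
  "quat_b m = word_class (quat_relations m) [(B, True)]"


section \<open>Directed Cayley graphs\<close>

definition cayley_digraph :: "('a, 'c) monoid_scheme \<Rightarrow> 'a set \<Rightarrow> 'a pair_pre_digraph" where
  "cayley_digraph G S =
     \<lparr>pverts = carrier G, parcs = {(g, g \<otimes>\<^bsub>G\<^esub> s) | g s. g \<in> carrier G \<and> s \<in> S}\<rparr>"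


section \<open>Lin--Lu--Yau curvature of directed graphs\<close>

text \<open>The distance is \<open>\<infinity>\<close> if there is no directed path.\<close>

definition digraph_dist :: "'v pair_pre_digraph \<Rightarrow> 'v \<Rightarrow> 'v \<Rightarrow> enat" where
  "digraph_dist G x y = (INF p\<in>{p. pre_digraph.awalk (with_proj G) x p y}. enat (length p))"

definition lazy_walk :: "'v pair_pre_digraph \<Rightarrow> real \<Rightarrow> 'v \<Rightarrow> 'v \<Rightarrow> real" where
  "lazy_walk G \<alpha> x v =
     (if v = x then \<alpha>
      else if (x, v) \<in> parcs G then (1 - \<alpha>) / real (out_degree (with_proj G) x)
      else 0)"

definition couplings :: "'v set \<Rightarrow> ('v \<Rightarrow> real) \<Rightarrow> ('v \<Rightarrow> real) \<Rightarrow> ('v \<times> 'v \<Rightarrow> real) set" where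
  "couplings V \<mu> \<nu> =
     {C. (\<forall>u\<in>V. \<forall>v\<in>V. C (u, v) \<in> {0..1}) \<and>
         (\<forall>u\<in>V. ((\<lambda>v. C (u, v)) has_sum \<mu> u) V) \<and>
         (\<forall>v\<in>V. ((\<lambda>u. C (u, v)) has_sum \<nu> v) V)}"

definition wasserstein :: "'v pair_pre_digraph \<Rightarrow> ('v \<Rightarrow> real) \<Rightarrow> ('v \<Rightarrow> real) \<Rightarrow> ennreal" where
  "wasserstein G \<mu> \<nu> =
     (INF C\<in>couplings (pverts G) \<mu> \<nu>.
        \<Sum>\<^sub>\<infinity>(u, v)\<in>pverts G \<times> pverts G. ennreal (C (u, v)) * ennreal_of_enat (digraph_dist G u v))"

text \<open>The following two notions are meant for distinct \<open>x\<close>, \<open>y\<close> in a strongly connected graph,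
  where the Wasserstein distance and \<open>d(x, y)\<close> are finite.\<close>

definition lazy_curvature :: "'v pair_pre_digraph \<Rightarrow> real \<Rightarrow> 'v \<Rightarrow> 'v \<Rightarrow> real" where
  "lazy_curvature G \<alpha> x y =
     1 - enn2real (wasserstein G (lazy_walk G \<alpha> x) (lazy_walk G \<alpha> y))
         / real (the_enat (digraph_dist G x y))"

text \<open>The limit defining the Lin--Lu--Yau curvature exists and equals \<open>k\<close>.\<close>

definition has_LLY_curvature :: "'v pair_pre_digraph \<Rightarrow> 'v \<Rightarrow> 'v \<Rightarrow> real \<Rightarrow> bool" where
  "has_LLY_curvature G x y k \<longleftrightarrow>
     ((\<lambda>\<alpha>. lazy_curvature G \<alpha> x y / (1 - \<alpha>)) \<longlongrightarrow> k) (at_left 1)"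

end

theory Submission
  imports Defs "HOL-Number_Theory.Cong"
begin

text \<open>Both Wasserstein distances are computed exactly for every \<open>\<alpha> > 1/4\<close> by linear programming
  duality. An explicit transport plan gives the upper bound: the bulk of the mass at the identity
  moves along the arc, and each portion \<open>(1 - \<alpha>)/3\<close> of the rest stays or moves along a directed
  path of length \<open>1\<close> or \<open>min (m - 1) 3\<close>. An explicit function that grows by at most one along every arc gives the
  matching lower bound. Hence \<open>\<kappa>\<^sub>\<alpha> / (1 - \<alpha>)\<close> is constant near \<open>\<alpha> = 1\<close>.\<close>

section \<open>Transport on directed graphs\<close>

text \<open>The cost \<open>min (m - 1) 3\<close> comes from elements with two short spellings.
  Moving from b to a b^-1, or from b^-1 to a b, is right multiplication by a^(m-1) = b a b = b^-1 a
  b^-1; moving from a to b a is right multiplication by a^(m-2) b^-1 = b a^2. In each case one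
  spelling has length m - 1 and another has length 3, hence the change of behaviour at m = 4. The
  plan for (e,a) contains two such moves, the plan for (e,b) one. The bound 1/4 on \<alpha> is where
  \<alpha> - (1 - \<alpha>)/3 becomes positive, the mass that the second plan sends along its arc.

  The obstacle is the presentation: relations yield equalities, enough for short walks, but
  potentials and distinctness of generators require knowing when two words differ. Letting letters
  act on pairs of an exponent and a coset supplies this.\<close>

lemma digraph_dist_le: "pre_digraph.awalk (with_proj G) x p y \<Longrightarrow> digraph_dist G x y \<le> enat (length p)"
  unfolding digraph_dist_def by (rule INF_lower) simp

lemma pcas_lipschitz:
  fixes f :: "'v \<Rightarrow> real"
  assumes "\<And>u v. (u, v) \<in> parcs G \<Longrightarrow> f v \<le> f u + 1"
    and "set p \<subseteq> parcs G" "pcas x p y"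
  shows "f y - f x \<le> real (length p)"
  using assms(2,3)
proof (induction p arbitrary: x)
  case (Cons e p)
  then show ?case
    using assms(1)[of x "snd e"] Cons.IH[of "snd e"] by (cases e) fastforce
qed simp

text \<open>A finite distance is attained by a walk, since a nonempty set of \<open>enat\<close> has
  a least element, and the bound is read off along that walk. Negative differences are cut to 0 by
  \<open>ennreal\<close>.\<close>

lemma ennreal_le_digraph_dist:
  assumes lip: "\<And>u v. (u, v) \<in> parcs G \<Longrightarrow> f v \<le> f u + 1"
  shows "ennreal (f y - f x) \<le> ennreal_of_enat (digraph_dist G x y)"
proof (cases "digraph_dist G x y")
  case (enat n)
  let ?P = "{p. pre_digraph.awalk (with_proj G) x p y}"
  have "?P \<noteq> {}"
  proof
    assume "?P = {}"
    then have "digraph_dist G x y = \<infinity>"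
      unfolding digraph_dist_def by (simp add: Inf_enat_def)
    with enat show False
      by simp
  qed
  then obtain q where "q \<in> ?P"
    unfolding ex_in_conv[symmetric] ..
  then have "enat (length q) \<in> (\<lambda>p. enat (length p)) ` ?P"
    by (rule imageI)
  then have "digraph_dist G x y \<in> (\<lambda>p. enat (length p)) ` ?P"
    unfolding digraph_dist_def by (rule wellorder_InfI)
  then obtain p where "digraph_dist G x y = enat (length p)"
    and "pre_digraph.awalk (with_proj G) x p y"
    by (rule imageE) simp
  moreover from this have n: "length p = n"
    using enat by simp
  ultimately have "set p \<subseteq> parcs G" "pcas x p y"
    by (simp_all add: pre_digraph.awalk_def cas_with_proj_eq)
  then have "f y - f x \<le> real n"
    using pcas_lipschitz[of G f p x y] lip n by blast
  then show ?thesis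
    using enat by (simp add: ennreal_of_nat_eq_real_of_nat ennreal_leI)
qed simp

lemma digraph_dist_arc:
  assumes "x \<in> pverts G" "(x, y) \<in> parcs G" "x \<noteq> y"
  shows "digraph_dist G x y = 1"
proof (rule antisym)
  show "digraph_dist G x y \<le> 1"
    using digraph_dist_le[of G x "[(x, y)]" y] assms
    by (simp add: pre_digraph.awalk_def pre_digraph.cas.simps one_enat_def)
  \<comment> \<open>The indicator of \<open>y\<close> serves as potential: it excludes distance
    0.\<close>
  have "ennreal (of_bool (y = y) - of_bool (x = y)) \<le> ennreal_of_enat (digraph_dist G x y)"
    by (rule ennreal_le_digraph_dist) simp
  then have "ennreal_of_enat 1 \<le> ennreal_of_enat (digraph_dist G x y)"
    using assms by simp
  then show "1 \<le> digraph_dist G x y"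
    by (simp only: ennreal_of_enat_le_iff)
qed

text \<open>Weak Kantorovich duality. The Lipschitz condition is one-sided because the distance is
  not symmetric: \<open>f\<close> may drop by any amount along an arc.\<close>

lemma sum_lipschitz_le_wasserstein:
  assumes fin: "finite (pverts G)"
    and lip: "\<And>u v. (u, v) \<in> parcs G \<Longrightarrow> f v \<le> f u + 1"
  shows "ennreal ((\<Sum>v\<in>pverts G. f v * \<nu> v) - (\<Sum>v\<in>pverts G. f v * \<mu> v)) \<le> wasserstein G \<mu> \<nu>"
  unfolding wasserstein_def
proof (rule INF_greatest)
  let ?V = "pverts G"
  fix C assume "C \<in> couplings ?V \<mu> \<nu>"
  then have nonneg: "\<And>u v. u \<in> ?V \<Longrightarrow> v \<in> ?V \<Longrightarrow> 0 \<le> C (u, v)"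
    and "\<And>u. u \<in> ?V \<Longrightarrow> ((\<lambda>v. C (u, v)) has_sum \<mu> u) ?V"
    and "\<And>v. v \<in> ?V \<Longrightarrow> ((\<lambda>u. C (u, v)) has_sum \<nu> v) ?V"
    by (auto simp: couplings_def)
  then have \<mu>: "\<And>u. u \<in> ?V \<Longrightarrow> \<mu> u = (\<Sum>v\<in>?V. C (u, v))"
    and \<nu>: "\<And>v. v \<in> ?V \<Longrightarrow> \<nu> v = (\<Sum>u\<in>?V. C (u, v))"
    using fin by (metis has_sum_finite has_sum_unique)+
  have "(\<Sum>v\<in>?V. f v * \<nu> v) - (\<Sum>u\<in>?V. f u * \<mu> u)
      = (\<Sum>u\<in>?V. \<Sum>v\<in>?V. f v * C (u, v)) - (\<Sum>u\<in>?V. \<Sum>v\<in>?V. f u * C (u, v))"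
    by (subst sum.swap) (simp add: \<mu> \<nu> sum_distrib_left)
  also have "\<dots> = (\<Sum>(u, v)\<in>?V \<times> ?V. C (u, v) * (f v - f u))"
    by (simp add: sum.cartesian_product sum_subtractf algebra_simps case_prod_unfold)
  \<comment> \<open>With the positive part every term is nonnegative, so \<open>ennreal\<close>
    commutes with the sum and the products.\<close>
  also have "\<dots> \<le> (\<Sum>(u, v)\<in>?V \<times> ?V. C (u, v) * max 0 (f v - f u))"
    using nonneg by (intro sum_mono) (auto intro: mult_left_mono)
  finally have "ennreal ((\<Sum>v\<in>?V. f v * \<nu> v) - (\<Sum>u\<in>?V. f u * \<mu> u))
      \<le> ennreal (\<Sum>(u, v)\<in>?V \<times> ?V. C (u, v) * max 0 (f v - f u))"
    by (rule ennreal_leI)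
  also have "\<dots> = (\<Sum>(u, v)\<in>?V \<times> ?V. ennreal (C (u, v) * max 0 (f v - f u)))"
    using nonneg by (subst sum_ennreal[symmetric]) (auto intro: sum.cong)
  also have "\<dots> \<le> (\<Sum>(u, v)\<in>?V \<times> ?V. ennreal (C (u, v)) * ennreal_of_enat (digraph_dist G u v))"
    using nonneg ennreal_le_digraph_dist[OF lip]
    by (intro sum_mono) (auto simp: ennreal_mult max_def ennreal_neg intro!: mult_left_mono)
  also have "\<dots> = (\<Sum>\<^sub>\<infinity>(u, v)\<in>?V \<times> ?V. ennreal (C (u, v)) * ennreal_of_enat (digraph_dist G u v))"
    using fin by simp
  finally show "ennreal ((\<Sum>v\<in>?V. f v * \<nu> v) - (\<Sum>u\<in>?V. f u * \<mu> u))
      \<le> (\<Sum>\<^sub>\<infinity>(u, v)\<in>?V \<times> ?V. ennreal (C (u, v)) * ennreal_of_enat (digraph_dist G u v))" .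
qed

text \<open>A tuple \<open>(u, v, w, n)\<close> moves the mass \<open>w\<close> from \<open>u\<close> to \<open>v\<close> at a cost of at most \<open>w * n\<close>.\<close>

lemma wasserstein_le_plan:
  fixes P :: "('v \<times> 'v \<times> real \<times> nat) list"
  assumes fin: "finite (pverts G)"
    and plan: "\<And>u v w n. (u, v, w, n) \<in> set P \<Longrightarrow>
      u \<in> pverts G \<and> v \<in> pverts G \<and> 0 \<le> w \<and> digraph_dist G u v \<le> enat n"
    and \<mu>: "\<And>x. x \<in> pverts G \<Longrightarrow> \<mu> x = (\<Sum>(u, v, w, n)\<leftarrow>P. w * of_bool (x = u))"
    and \<nu>: "\<And>x. x \<in> pverts G \<Longrightarrow> \<nu> x = (\<Sum>(u, v, w, n)\<leftarrow>P. w * of_bool (x = v))"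
    and total: "(\<Sum>(u, v, w, n)\<leftarrow>P. w) \<le> 1"
  shows "wasserstein G \<mu> \<nu> \<le> ennreal (\<Sum>(u, v, w, n)\<leftarrow>P. w * real n)"
proof -
  let ?V = "pverts G"
  \<comment> \<open>Entries with the same endpoints add up, so both marginals and the cost can be
    computed by induction on the list.\<close>
  define C where "C = (\<lambda>z. \<Sum>(u, v, w, n)\<leftarrow>P. w * of_bool (z = (u, v)))"
  have C_nonneg: "0 \<le> C z" for z
    unfolding C_def using plan by (intro sum_list_nonneg) auto
  have "C z \<le> (\<Sum>(u, v, w, n)\<leftarrow>P. w)" for z
    unfolding C_def using plan by (intro sum_list_mono) auto
  then have C_le: "C z \<le> 1" for z
    using total order_trans by blast
  have row: "(\<Sum>v\<in>?V. C (x, v)) = (\<Sum>(u, v, w, n)\<leftarrow>P. w * of_bool (x = u))" for x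
    unfolding C_def using plan
  proof (induction P)
    case (Cons r P)
    obtain u v w n where r: "r = (u, v, w, n)" by (cases r)
    have "(\<Sum>y\<in>?V. w * of_bool (x = u \<and> y = v)) = w * of_bool (x = u)"
      using fin Cons.prems[of u v w n] by (simp add: r if_distrib of_bool_def cong: if_cong)
    moreover note Cons.IH[OF Cons.prems[OF list.set_intros(2)]]
    ultimately show ?case
      by (simp add: r sum.distrib)
  qed simp
  have col: "(\<Sum>u\<in>?V. C (u, y)) = (\<Sum>(u, v, w, n)\<leftarrow>P. w * of_bool (y = v))" for y
    unfolding C_def using plan
  proof (induction P)
    case (Cons r P)
    obtain u v w n where r: "r = (u, v, w, n)" by (cases r)
    have "(\<Sum>x\<in>?V. w * of_bool (x = u \<and> y = v)) = w * of_bool (y = v)"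
      using fin Cons.prems[of u v w n] by (simp add: r if_distrib of_bool_def cong: if_cong)
    moreover note Cons.IH[OF Cons.prems[OF list.set_intros(2)]]
    ultimately show ?case
      by (simp add: r sum.distrib)
  qed simp
  have "C \<in> couplings ?V \<mu> \<nu>"
    using fin C_nonneg C_le \<mu> \<nu> by (auto simp: couplings_def simp flip: row col)
  then have "wasserstein G \<mu> \<nu>
      \<le> (\<Sum>\<^sub>\<infinity>(u, v)\<in>?V \<times> ?V. ennreal (C (u, v)) * ennreal_of_enat (digraph_dist G u v))"
    unfolding wasserstein_def by (rule INF_lower)
  also have "\<dots> = (\<Sum>z\<in>?V \<times> ?V. ennreal (C z) * ennreal_of_enat (digraph_dist G (fst z) (snd z)))"
    using fin by (simp add: case_prod_unfold)
  also have "\<dots> \<le> ennreal (\<Sum>(u, v, w, n)\<leftarrow>P. w * real n)"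
    unfolding C_def using plan
  proof (induction P)
    case (Cons r P)
    obtain u v w n where r: "r = (u, v, w, n)" by (cases r)
    let ?C = "\<lambda>z. \<Sum>(u, v, w, n)\<leftarrow>P. w * of_bool (z = (u, v))"
    let ?d = "\<lambda>z. ennreal_of_enat (digraph_dist G (fst z) (snd z))"
    have uv: "(u, v) \<in> ?V \<times> ?V" "0 \<le> w" "digraph_dist G u v \<le> enat n"
      using Cons.prems[of u v w n] by (auto simp: r)
    have nonneg: "0 \<le> ?C z" for z
      using Cons.prems by (intro sum_list_nonneg) (fastforce simp: r)
    have nonneg': "0 \<le> (\<Sum>(u, v, w, n)\<leftarrow>P. w * real n)"
      using Cons.prems by (intro sum_list_nonneg) (fastforce simp: r)
    have "(\<Sum>z\<in>?V \<times> ?V. ennreal (w * of_bool (z = (u, v)) + ?C z) * ?d z)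
        = (\<Sum>z\<in>?V \<times> ?V. (if z = (u, v) then ennreal w * ?d z else 0) + ennreal (?C z) * ?d z)"
      using uv nonneg by (intro sum.cong) (auto simp: ennreal_plus distrib_right)
    also have "\<dots> = ennreal w * ennreal_of_enat (digraph_dist G u v)
        + (\<Sum>z\<in>?V \<times> ?V. ennreal (?C z) * ?d z)"
      using fin uv by (simp add: sum.distrib)
    also have "\<dots> \<le> ennreal w * ennreal (real n) + ennreal (\<Sum>(u, v, w, n)\<leftarrow>P. w * real n)"
    proof (intro add_mono mult_left_mono)
      show "ennreal_of_enat (digraph_dist G u v) \<le> ennreal (real n)"
        using uv(3) by (metis ennreal_of_enat_enat ennreal_of_enat_le_iff ennreal_of_nat_eq_real_of_nat)
    qed (use Cons in auto)
    also have "\<dots> = ennreal (w * real n + (\<Sum>(u, v, w, n)\<leftarrow>P. w * real n))"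
      using uv nonneg' by (simp add: ennreal_mult ennreal_plus)
    finally show ?case
      by (simp add: r)
  qed simp
  finally show ?thesis .
qed

text \<open>Left multiplication by \<open>g\<close> is injective and no generator is the identity,
  so the atoms at the neighbours are distinct from each other and from \<open>g\<close>. The form as
  a sum of point masses can be compared with a transport plan entry by entry.\<close>

lemma lazy_walk_cayley_digraph:
  assumes "group H" "S \<subseteq> carrier H" "finite S" "\<one>\<^bsub>H\<^esub> \<notin> S" "g \<in> carrier H"
  shows "lazy_walk (cayley_digraph H S) \<alpha> g x =
    \<alpha> * of_bool (x = g) + (\<Sum>s\<in>S. (1 - \<alpha>) / real (card S) * of_bool (x = g \<otimes>\<^bsub>H\<^esub> s))"
proof -
  interpret group H by fact
  let ?G = "cayley_digraph H S" and ?e = "(1 - \<alpha>) / real (card S)"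
  have arc: "(g, v) \<in> parcs ?G \<longleftrightarrow> (\<exists>s\<in>S. v = g \<otimes>\<^bsub>H\<^esub> s)" for v
    using assms by (auto simp: cayley_digraph_def)
  have inj: "inj_on (\<lambda>s. g \<otimes>\<^bsub>H\<^esub> s) S"
    using assms by (auto simp: inj_on_def subset_iff)
  have "out_arcs (with_proj ?G) g = (\<lambda>s. (g, g \<otimes>\<^bsub>H\<^esub> s)) ` S"
    using arc by (auto simp: out_arcs_def)
  then have deg: "out_degree (with_proj ?G) g = card S"
    using inj by (simp add: out_degree_def card_image inj_on_def)
  show ?thesis
  proof (cases "\<exists>s\<in>S. x = g \<otimes>\<^bsub>H\<^esub> s")
    case True
    then obtain s where s: "s \<in> S" "x = g \<otimes>\<^bsub>H\<^esub> s" by blast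
    have "g \<otimes>\<^bsub>H\<^esub> s \<noteq> g"
      using s assms by (auto simp: subset_iff)
    then have "lazy_walk ?G \<alpha> g x = ?e"
      using arc s by (auto simp: lazy_walk_def deg)
    moreover have "(\<Sum>t\<in>S. ?e * of_bool (x = g \<otimes>\<^bsub>H\<^esub> t)) = (\<Sum>t\<in>S. if t = s then ?e else 0)"
      using s inj by (intro sum.cong) (auto simp: inj_on_def)
    moreover have "(\<Sum>t\<in>S. if t = s then ?e else 0) = ?e"
      using s assms(3) by simp
    ultimately show ?thesis
      using s \<open>g \<otimes>\<^bsub>H\<^esub> s \<noteq> g\<close> by simp
  next
    case False
    then have "(\<Sum>t\<in>S. ?e * of_bool (x = g \<otimes>\<^bsub>H\<^esub> t)) = 0"
      by (intro sum.neutral) auto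
    moreover have "(g, x) \<notin> parcs ?G"
      using arc False by blast
    ultimately show ?thesis
      by (simp add: lazy_walk_def)
  qed
qed

lemma sum_lazy_walk_cayley_digraph:
  assumes "group H" "finite (carrier H)" "S \<subseteq> carrier H" "\<one>\<^bsub>H\<^esub> \<notin> S" "g \<in> carrier H"
  shows "(\<Sum>x\<in>carrier H. f x * lazy_walk (cayley_digraph H S) \<alpha> g x) =
    \<alpha> * f g + (1 - \<alpha>) / real (card S) * (\<Sum>s\<in>S. f (g \<otimes>\<^bsub>H\<^esub> s))"
proof -
  interpret group H by fact
  let ?e = "(1 - \<alpha>) / real (card S)"
  have point: "(\<Sum>x\<in>carrier H. f x * (c * of_bool (x = y))) = c * f y" if "y \<in> carrier H" for c y
    using that assms(2) by (simp add: of_bool_def if_distrib mult.commute cong: if_cong)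
  have "(\<Sum>x\<in>carrier H. f x * lazy_walk (cayley_digraph H S) \<alpha> g x)
      = (\<Sum>x\<in>carrier H. f x * (\<alpha> * of_bool (x = g)))
        + (\<Sum>s\<in>S. \<Sum>x\<in>carrier H. f x * (?e * of_bool (x = g \<otimes>\<^bsub>H\<^esub> s)))"
    using assms finite_subset[OF assms(3,2)]
    by (subst sum.swap) (simp add: lazy_walk_cayley_digraph distrib_left sum.distrib sum_distrib_left)
  also have "\<dots> = \<alpha> * f g + (\<Sum>s\<in>S. ?e * f (g \<otimes>\<^bsub>H\<^esub> s))"
    using assms by (intro arg_cong2[of _ _ _ _ "(+)"] sum.cong refl point) auto
  finally show ?thesis
    by (simp add: sum_distrib_left)
qed

lemma has_LLY_curvatureI:
  assumes dist: "digraph_dist G x y = 1"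
    and "c < 1" "k \<le> 1"
    and W: "\<And>\<alpha>. c < \<alpha> \<Longrightarrow> 0 < \<alpha> \<Longrightarrow> \<alpha> < 1 \<Longrightarrow>
      wasserstein G (lazy_walk G \<alpha> x) (lazy_walk G \<alpha> y) = ennreal (1 - k * (1 - \<alpha>))"
  shows "has_LLY_curvature G x y k"
proof -
  have "lazy_curvature G \<alpha> x y / (1 - \<alpha>) = k" if \<alpha>: "max 0 c < \<alpha>" "\<alpha> < 1" for \<alpha>
  proof -
    \<comment> \<open>\<open>enn2real\<close> inverts \<open>ennreal\<close> only on nonnegative
      reals; \<open>k \<le> 1\<close> ensures that the claimed distance is one.\<close>
    have "k * (1 - \<alpha>) \<le> 1 * (1 - \<alpha>)"
      using assms(3) \<alpha> by (intro mult_right_mono) auto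
    also have "\<dots> \<le> 1"
      using \<alpha> by simp
    finally have "0 \<le> 1 - k * (1 - \<alpha>)"
      by simp
    then show ?thesis
      using \<alpha> by (simp add: lazy_curvature_def dist W one_enat_def)
  qed
  then have "\<forall>\<^sub>F \<alpha> in at_left 1. lazy_curvature G \<alpha> x y / (1 - \<alpha>) = k"
    using assms(2) by (intro eventually_at_leftI[of "max 0 c"]) auto
  then show ?thesis
    unfolding has_LLY_curvature_def by (rule tendsto_eventually)
qed


section \<open>Coordinates on the generalized quaternion group\<close>

text \<open>The pair \<open>(i, s)\<close> stands for \<open>a\<^sup>i b\<^sup>s\<close>; \<open>quat_step\<close> is right multiplication by a letter. The
  exponent \<open>i\<close> is not reduced modulo \<open>2m\<close>, so that inverse letters act by inverse maps.\<close>

fun quat_step :: "nat \<Rightarrow> int \<times> bool \<Rightarrow> quat_gen \<times> bool \<Rightarrow> int \<times> bool" where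
  "quat_step m (i, s) (A, t) = (if s = t then i - 1 else i + 1, s)"
| "quat_step m (i, s) (B, t) = (if s \<noteq> t then i else if s then i + int m else i - int m, \<not> s)"

definition quat_eq :: "nat \<Rightarrow> int \<times> bool \<Rightarrow> int \<times> bool \<Rightarrow> bool" where
  "quat_eq m p q \<longleftrightarrow> snd p = snd q \<and> [fst p = fst q] (mod 2 * int m)"

lemma quat_eq_refl [simp]: "quat_eq m p p"
  by (simp add: quat_eq_def)

lemma quat_eq_sym: "quat_eq m p q \<Longrightarrow> quat_eq m q p"
  by (auto simp: quat_eq_def cong_sym)

lemma quat_eq_trans: "quat_eq m p q \<Longrightarrow> quat_eq m q r \<Longrightarrow> quat_eq m p r"
  by (auto simp: quat_eq_def intro: cong_trans)

lemma quat_eq_step: "quat_eq m p q \<Longrightarrow> quat_eq m (quat_step m p l) (quat_step m q l)"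
  by (cases "(m, p, l)" rule: quat_step.cases; cases q)
     (auto simp: quat_eq_def intro: cong_add cong_diff)

lemma quat_eq_foldl:
  "quat_eq m p q \<Longrightarrow> quat_eq m (foldl (quat_step m) p w) (foldl (quat_step m) q w)"
  by (induction w arbitrary: p q) (simp_all add: quat_eq_step)

lemma foldl_quat_step_replicate_A:
  "foldl (quat_step m) (i, s) (replicate n (A, t)) = (if s = t then i - int n else i + int n, s)"
  by (induction n arbitrary: i) auto

lemma quat_eq_foldl_relation:
  assumes "(u, v) \<in> quat_relations m"
  shows "quat_eq m (foldl (quat_step m) p u) (foldl (quat_step m) p v)"
proof -
  obtain i s where "p = (i, s)" by fastforce
  \<comment> \<open>On the coset of b, the word b^2 adds m to the exponent while a^m subtracts m;
    the results agree only modulo 2m.\<close>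
  moreover have "[i + int m = i - int m] (mod 2 * int m)"
    by (simp add: cong_iff_dvd_diff)
  ultimately show ?thesis
    using assms
    by (auto simp: quat_relations_def foldl_quat_step_replicate_A quat_eq_def numeral_2_eq_2
        cong_iff_dvd_diff)
qed

text \<open>Soundness of the action: cancellation holds exactly on unreduced exponents, the three
  relations hold modulo 2m. This is the means of proving that elements of the presented group are
  different.\<close>

lemma quat_eq_foldl_word_cong:
  assumes "(u, v) \<in> word_cong (quat_relations m)"
  shows "quat_eq m (foldl (quat_step m) p u) (foldl (quat_step m) p v)"
  using assms
proof (induction arbitrary: p)
  case (trans u v w)
  then show ?case
    by (blast intro: quat_eq_trans)
next
  case (append u u' v v')
  show ?case
    using quat_eq_trans[OF quat_eq_foldl[OF append.IH(1)] append.IH(2)] by simp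
next
  case (cancel x s)
  then show ?case
    by (cases x; cases p) auto
qed (auto intro: quat_eq_sym quat_eq_trans quat_eq_foldl_relation)

section \<open>Multiplication and normal forms in the presented group\<close>

abbreviation quat_class :: "nat \<Rightarrow> quat_gen word \<Rightarrow> quat_gen word set" where
  "quat_class m \<equiv> word_class (quat_relations m)"

lemma group_quat_group: "group (quat_group m)"
  by (simp add: quat_group_def group_presented_group)

lemma quat_class_closed [simp]: "quat_class m w \<in> carrier (quat_group m)"
  by (simp add: quat_group_def carrier_presented_group)

lemma mult_quat_class: "quat_class m u \<otimes>\<^bsub>quat_group m\<^esub> quat_class m v = quat_class m (u @ v)"
  by (simp add: quat_group_def mult_presented_group)

lemma one_quat_group: "\<one>\<^bsub>quat_group m\<^esub> = quat_class m []"
  by (simp add: quat_group_def one_presented_group)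

lemma quat_class_relations:
  "quat_class m (replicate (2 * m) (A, True)) = quat_class m []"
  "quat_class m (replicate 2 (B, True)) = quat_class m (replicate m (A, True))"
  "quat_class m [(B, False), (A, True), (B, True)] = quat_class m [(A, False)]"
  by (auto simp: word_class_eq_iff quat_relations_def intro!: word_cong.relation)

lemma inv_quat_class_letter:
  "inv\<^bsub>quat_group m\<^esub> quat_class m [(x, s)] = quat_class m [(x, \<not> s)]"
proof -
  interpret group "quat_group m" by (rule group_quat_group)
  have "quat_class m [(x, \<not> s)] \<otimes>\<^bsub>quat_group m\<^esub> quat_class m [(x, s)] = \<one>\<^bsub>quat_group m\<^esub>"
    using word_cong.cancel[of x "\<not> s"] by (simp add: mult_quat_class one_quat_group word_class_eq_iff)
  then show ?thesis
    by (intro inv_equality) auto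
qed

lemma quat_class_replicate:
  "quat_class m (replicate n l) = quat_class m [l] [^]\<^bsub>quat_group m\<^esub> n"
proof -
  interpret group "quat_group m" by (rule group_quat_group)
  show ?thesis
  proof (induction n)
    case (Suc n)
    have "quat_class m (replicate (Suc n) l) = quat_class m (replicate n l @ [l])"
      by (simp only: replicate_Suc replicate_append_same)
    with Suc show ?case
      by (simp flip: mult_quat_class)
  qed (simp add: one_quat_group)
qed

definition quat_elem :: "nat \<Rightarrow> int \<times> bool \<Rightarrow> quat_gen word set" where
  "quat_elem m = (\<lambda>(i, s). quat_a m [^]\<^bsub>quat_group m\<^esub> i \<otimes>\<^bsub>quat_group m\<^esub>
     (if s then quat_b m else \<one>\<^bsub>quat_group m\<^esub>))"

text \<open>Two consequences of the relations settle all cases: b a = a^-1 b carries powers of a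
  across b, and b^-1 = a^-m b removes the inverse of b.\<close>

lemma quat_elem_step:
  "quat_elem m p \<otimes>\<^bsub>quat_group m\<^esub> quat_class m [l] = quat_elem m (quat_step m p l)"
proof -
  interpret group "quat_group m" by (rule group_quat_group)
  let ?a = "quat_a m" and ?b = "quat_b m" and ?G = "quat_group m"
  have a: "?a \<in> carrier ?G" and b: "?b \<in> carrier ?G"
    by (simp_all add: quat_a_def quat_b_def)
  have a': "quat_class m [(A, False)] = inv\<^bsub>?G\<^esub> ?a" and b': "quat_class m [(B, False)] = inv\<^bsub>?G\<^esub> ?b"
    by (simp_all add: quat_a_def quat_b_def inv_quat_class_letter)
  have "inv\<^bsub>?G\<^esub> ?b \<otimes>\<^bsub>?G\<^esub> (?a \<otimes>\<^bsub>?G\<^esub> ?b) = inv\<^bsub>?G\<^esub> ?a"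
    using quat_class_relations(3)[of m]
    by (simp add: quat_a_def quat_b_def inv_quat_class_letter mult_quat_class)
  then have ab: "?a \<otimes>\<^bsub>?G\<^esub> ?b = ?b \<otimes>\<^bsub>?G\<^esub> inv\<^bsub>?G\<^esub> ?a"
    using a b by (metis inv_closed inv_solve_left m_closed)
  then have ba: "?b \<otimes>\<^bsub>?G\<^esub> ?a = inv\<^bsub>?G\<^esub> ?a \<otimes>\<^bsub>?G\<^esub> ?b"
    using a b by (metis inv_closed inv_solve_left inv_solve_right m_assoc m_closed)
  have bb: "?b \<otimes>\<^bsub>?G\<^esub> ?b = ?a [^]\<^bsub>?G\<^esub> int m"
    using quat_class_relations(2)[of m] b
    by (simp add: quat_a_def quat_b_def quat_class_replicate numeral_2_eq_2 int_pow_int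
        del: replicate_Suc)
  then have binv: "inv\<^bsub>?G\<^esub> ?b = ?a [^]\<^bsub>?G\<^esub> (- int m) \<otimes>\<^bsub>?G\<^esub> ?b"
    using a b by (metis int_pow_closed int_pow_neg inv_closed inv_mult_group inv_solve_right m_assoc m_closed)
  obtain i s x t where [simp]: "p = (i, s)" "l = (x, t)" by fastforce
  have pow: "?a [^]\<^bsub>?G\<^esub> (i + 1) = ?a [^]\<^bsub>?G\<^esub> i \<otimes>\<^bsub>?G\<^esub> ?a"
    "?a [^]\<^bsub>?G\<^esub> (i - 1) = ?a [^]\<^bsub>?G\<^esub> i \<otimes>\<^bsub>?G\<^esub> inv\<^bsub>?G\<^esub> ?a"
    "?a [^]\<^bsub>?G\<^esub> (i + int m) = ?a [^]\<^bsub>?G\<^esub> i \<otimes>\<^bsub>?G\<^esub> ?a [^]\<^bsub>?G\<^esub> int m"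
    "?a [^]\<^bsub>?G\<^esub> (i - int m) = ?a [^]\<^bsub>?G\<^esub> i \<otimes>\<^bsub>?G\<^esub> ?a [^]\<^bsub>?G\<^esub> (- int m)"
    using a int_pow_mult[of ?a i 1] int_pow_mult[of ?a i "-1"] int_pow_mult[of ?a i "int m"]
      int_pow_mult[of ?a i "- int m"] int_pow_neg[of ?a 1]
    by (auto simp: int_pow_1)
  show ?thesis
  proof (cases x)
    case A
    then have l: "quat_class m [l] = (if t then ?a else inv\<^bsub>?G\<^esub> ?a)"
      using a' by (simp add: quat_a_def)
    show ?thesis
      unfolding l using a b A ab ba by (auto simp: quat_elem_def pow m_assoc)
  next
    case B
    then have l: "quat_class m [l] = (if t then ?b else inv\<^bsub>?G\<^esub> ?b)"
      using b' by (simp add: quat_b_def)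
    show ?thesis
      unfolding l using a b B bb[symmetric]
      by (cases s; cases t) (simp_all add: quat_elem_def pow m_assoc, simp only: binv)
  qed
qed


lemma quat_elem_closed [simp]: "quat_elem m p \<in> carrier (quat_group m)"
proof -
  interpret group "quat_group m" by (rule group_quat_group)
  have "quat_a m \<in> carrier (quat_group m)" "quat_b m \<in> carrier (quat_group m)"
    by (simp_all add: quat_a_def quat_b_def)
  then show ?thesis
    by (auto simp: quat_elem_def split: prod.split)
qed

lemma quat_elem_foldl:
  "quat_elem m p \<otimes>\<^bsub>quat_group m\<^esub> quat_class m w = quat_elem m (foldl (quat_step m) p w)"
proof (induction w arbitrary: p)
  case Nil
  interpret group "quat_group m" by (rule group_quat_group)
  show ?case
    by (simp flip: one_quat_group)
next
  case (Cons l w)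
  interpret group "quat_group m" by (rule group_quat_group)
  have "quat_class m (l # w) = quat_class m [l] \<otimes>\<^bsub>quat_group m\<^esub> quat_class m w"
    by (simp add: mult_quat_class)
  then have "quat_elem m p \<otimes>\<^bsub>quat_group m\<^esub> quat_class m (l # w) =
      (quat_elem m p \<otimes>\<^bsub>quat_group m\<^esub> quat_class m [l]) \<otimes>\<^bsub>quat_group m\<^esub> quat_class m w"
    by (simp add: m_assoc)
  then show ?case
    by (simp add: quat_elem_step Cons.IH)
qed

lemma quat_elem_0: "quat_elem m (0, False) = \<one>\<^bsub>quat_group m\<^esub>"
proof -
  interpret group "quat_group m" by (rule group_quat_group)
  show ?thesis
    by (simp add: quat_elem_def)
qed

lemma quat_class_eq_quat_elem: "quat_class m w = quat_elem m (foldl (quat_step m) (0, False) w)"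
proof -
  interpret group "quat_group m" by (rule group_quat_group)
  show ?thesis
    using quat_elem_foldl[of m "(0, False)" w] by (simp add: quat_elem_0)
qed

lemma foldl_quat_step_surj: "\<exists>w. foldl (quat_step m) (0, False) w = p"
proof -
  obtain i s where p: "p = (i, s)" by fastforce
  have "foldl (quat_step m) (0, False)
      (replicate (nat \<bar>i\<bar>) (A, 0 \<le> i) @ (if s then [(B, True)] else [])) = p"
    by (simp add: p foldl_quat_step_replicate_A)
  then show ?thesis ..
qed

text \<open>Equal elements come from congruent words, which act alike on the coordinates of the
  identity; conversely a^(2m) = e identifies exponents that are congruent modulo 2m.\<close>

lemma quat_elem_eq_iff: "quat_elem m p = quat_elem m q \<longleftrightarrow> quat_eq m p q"
proof
  assume *: "quat_elem m p = quat_elem m q"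
  obtain u v where p: "p = foldl (quat_step m) (0, False) u"
    and q: "q = foldl (quat_step m) (0, False) v"
    using foldl_quat_step_surj by metis
  show "quat_eq m p q"
    using * unfolding p q quat_class_eq_quat_elem[symmetric]
    by (simp add: word_class_eq_iff quat_eq_foldl_word_cong)
next
  interpret group "quat_group m" by (rule group_quat_group)
  assume eq: "quat_eq m p q"
  obtain i s j where p: "p = (i, s)" and q: "q = (j, s)"
    using eq by (cases p; cases q) (simp add: quat_eq_def)
  then have "[i = j] (mod 2 * int m)"
    using eq by (simp add: quat_eq_def)
  then obtain k where "j = i + 2 * int m * k"
    by (auto simp: cong_iff_lin)
  moreover have a: "quat_a m \<in> carrier (quat_group m)"
    by (simp add: quat_a_def)
  moreover have "quat_a m [^]\<^bsub>quat_group m\<^esub> (2 * int m) = \<one>\<^bsub>quat_group m\<^esub>"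
    using quat_class_relations(1)[of m] int_pow_int[of "quat_group m" "quat_a m" "2 * m"]
    by (simp add: quat_class_replicate quat_a_def one_quat_group)
  ultimately have "quat_a m [^]\<^bsub>quat_group m\<^esub> j = quat_a m [^]\<^bsub>quat_group m\<^esub> i"
    using int_pow_pow[of "quat_a m" "2 * int m" k] by (simp add: int_pow_mult)
  then show "quat_elem m p = quat_elem m q"
    by (simp add: p q quat_elem_def)
qed

lemma carrier_quat_group: "carrier (quat_group m) = range (quat_elem m)"
proof -
  have "carrier (quat_group m) = range (quat_class m)"
    by (simp add: quat_group_def carrier_presented_group)
  then have "carrier (quat_group m) = quat_elem m ` range (foldl (quat_step m) (0, False))"
    by (simp add: quat_class_eq_quat_elem image_image)
  moreover have "range (foldl (quat_step m) (0, False)) = UNIV"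
    using foldl_quat_step_surj[of m] by (metis surjI)
  ultimately show ?thesis
    by simp
qed

lemma finite_carrier_quat_group:
  assumes "m > 0"
  shows "finite (carrier (quat_group m))"
proof -
  have "quat_elem m p \<in> quat_elem m ` ({0..<2 * int m} \<times> UNIV)" for p
  proof (rule image_eqI)
    show "quat_elem m p = quat_elem m (fst p mod (2 * int m), snd p)"
      by (simp add: quat_elem_eq_iff quat_eq_def)
    show "(fst p mod (2 * int m), snd p) \<in> {0..<2 * int m} \<times> UNIV"
      using assms by simp
  qed
  then have "carrier (quat_group m) \<subseteq> quat_elem m ` ({0..<2 * int m} \<times> UNIV)"
    unfolding carrier_quat_group by blast
  then show ?thesis
    by (rule finite_subset) simp
qed


section \<open>Curvature of the quaternion Cayley graph\<close>

abbreviation quat_letters :: "(quat_gen \<times> bool) set" where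
  "quat_letters \<equiv> {(A, True), (B, True), (B, False)}"

definition quat_digraph :: "nat \<Rightarrow> quat_gen word set pair_pre_digraph" where
  "quat_digraph m =
     cayley_digraph (quat_group m) {quat_a m, quat_b m, inv\<^bsub>quat_group m\<^esub> quat_b m}"

lemma quat_generators:
  "{quat_a m, quat_b m, inv\<^bsub>quat_group m\<^esub> quat_b m} = (\<lambda>l. quat_class m [l]) ` quat_letters"
  by (simp add: quat_a_def quat_b_def inv_quat_class_letter)

lemma pverts_quat_digraph: "pverts (quat_digraph m) = carrier (quat_group m)"
  by (simp add: quat_digraph_def cayley_digraph_def)

lemma parcs_quat_digraph:
  "parcs (quat_digraph m) = {(quat_elem m p, quat_elem m (quat_step m p l)) | p l. l \<in> quat_letters}"
proof -
  have "parcs (quat_digraph m) = {(x, x \<otimes>\<^bsub>quat_group m\<^esub> quat_class m [l]) | x l.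
      x \<in> range (quat_elem m) \<and> l \<in> quat_letters}"
    unfolding quat_digraph_def quat_generators cayley_digraph_def carrier_quat_group
      pair_pre_digraph.simps by blast
  also have "\<dots> = {(quat_elem m p, quat_elem m p \<otimes>\<^bsub>quat_group m\<^esub> quat_class m [l]) | p l.
      l \<in> quat_letters}"
    by blast
  finally show ?thesis
    by (simp only: quat_elem_step)
qed

text \<open>A word in the generators spells a directed walk, so a distance bound reduces to
  arithmetic modulo 2m.\<close>

lemma digraph_dist_quat_le:
  assumes "set w \<subseteq> quat_letters" "quat_eq m (foldl (quat_step m) p w) q"
  shows "digraph_dist (quat_digraph m) (quat_elem m p) (quat_elem m q) \<le> enat (length w)"
proof -
  have "\<exists>P. set P \<subseteq> parcs (quat_digraph m) \<and> length P = length w \<and>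
      pcas (quat_elem m p) P (quat_elem m (foldl (quat_step m) p w))"
    using assms(1)
  proof (induction w arbitrary: p)
    case (Cons l w)
    then obtain P where P: "set P \<subseteq> parcs (quat_digraph m)" "length P = length w"
      "pcas (quat_elem m (quat_step m p l)) P (quat_elem m (foldl (quat_step m) (quat_step m p l) w))"
      by (metis list.set_intros(2) subset_iff)
    let ?P = "(quat_elem m p, quat_elem m (quat_step m p l)) # P"
    have "set ?P \<subseteq> parcs (quat_digraph m)"
      using P(1) Cons.prems unfolding parcs_quat_digraph list.set by blast
    with P show ?case
      by (intro exI[of _ ?P]) simp
  qed simp
  then obtain P where "pre_digraph.awalk (with_proj (quat_digraph m)) (quat_elem m p) P
      (quat_elem m (foldl (quat_step m) p w))" "length P = length w"
    by (auto simp: pre_digraph.awalk_def cas_with_proj_eq pverts_quat_digraph)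
  moreover have "quat_elem m (foldl (quat_step m) p w) = quat_elem m q"
    using assms(2) by (simp add: quat_elem_eq_iff)
  ultimately show ?thesis
    using digraph_dist_le by metis
qed

text \<open>b and b^-1 = a^-m b differ because 2m does not divide m, and a differs from e because 2m
  does not divide 1. Hence every vertex has out-degree 3.\<close>

lemma quat_generators_distinct:
  assumes "m \<ge> 2"
  shows "inj_on (\<lambda>l. quat_class m [l]) quat_letters"
    and "\<one>\<^bsub>quat_group m\<^esub> \<notin> (\<lambda>l. quat_class m [l]) ` quat_letters"
proof -
  have "\<not> 2 * int m dvd int m" "\<not> 2 * int m dvd 1"
    using assms by (auto dest: zdvd_imp_le)
  then show "inj_on (\<lambda>l. quat_class m [l]) quat_letters"
    and "\<one>\<^bsub>quat_group m\<^esub> \<notin> (\<lambda>l. quat_class m [l]) ` quat_letters"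
    by (auto simp: inj_on_def quat_class_eq_quat_elem quat_elem_eq_iff one_quat_group quat_eq_def
        cong_iff_dvd_diff)
qed

lemma lazy_walk_quat_digraph:
  assumes "m \<ge> 2"
  shows "lazy_walk (quat_digraph m) \<alpha> (quat_elem m p) x = \<alpha> * of_bool (x = quat_elem m p)
    + (\<Sum>l\<in>quat_letters. (1 - \<alpha>) / 3 * of_bool (x = quat_elem m (quat_step m p l)))"
proof -
  note inj = quat_generators_distinct(1)[OF assms]
  show ?thesis
    unfolding quat_digraph_def quat_generators
    by (subst lazy_walk_cayley_digraph)
      (use quat_generators_distinct(2)[OF assms] in
        \<open>simp_all only: sum.reindex[OF inj] card_image[OF inj] quat_elem_step o_def
           group_quat_group quat_elem_closed, auto\<close>)
qed

lemma sum_lazy_walk_quat_digraph: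
  assumes "m \<ge> 2"
  shows "(\<Sum>x\<in>pverts (quat_digraph m). f x * lazy_walk (quat_digraph m) \<alpha> (quat_elem m p) x) =
    \<alpha> * f (quat_elem m p) + (1 - \<alpha>) / 3 * (\<Sum>l\<in>quat_letters. f (quat_elem m (quat_step m p l)))"
proof -
  note inj = quat_generators_distinct(1)[OF assms]
  show ?thesis
    unfolding quat_digraph_def quat_generators pverts_quat_digraph[unfolded quat_digraph_def quat_generators]
    by (subst sum_lazy_walk_cayley_digraph)
      (use assms quat_generators_distinct(2)[OF assms] in
        \<open>simp_all only: sum.reindex[OF inj] card_image[OF inj] quat_elem_step o_def
           group_quat_group quat_elem_closed finite_carrier_quat_group, auto\<close>)
qed

section \<open>Lower bounds from potentials\<close>

lemma quat_potential_le_wasserstein: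
  fixes \<phi> :: "int \<times> bool \<Rightarrow> real"
  assumes "m \<ge> 2"
    and eq: "\<And>p q. quat_eq m p q \<Longrightarrow> \<phi> p = \<phi> q"
    and lip: "\<And>p l. l \<in> quat_letters \<Longrightarrow> \<phi> (quat_step m p l) \<le> \<phi> p + 1"
  shows "ennreal ((\<alpha> * \<phi> q + (1 - \<alpha>) / 3 * (\<Sum>l\<in>quat_letters. \<phi> (quat_step m q l)))
      - (\<alpha> * \<phi> p + (1 - \<alpha>) / 3 * (\<Sum>l\<in>quat_letters. \<phi> (quat_step m p l))))
    \<le> wasserstein (quat_digraph m)
        (lazy_walk (quat_digraph m) \<alpha> (quat_elem m p)) (lazy_walk (quat_digraph m) \<alpha> (quat_elem m q))"
proof -
  \<comment> \<open>The choice of coordinates is harmless, as \<open>\<phi>\<close> is constant on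
    the classes of \<open>quat_eq\<close>.\<close>
  define f where "f = (\<lambda>x. \<phi> (SOME p. quat_elem m p = x))"
  have f: "f (quat_elem m p) = \<phi> p" for p
    unfolding f_def by (rule eq) (metis (mono_tags, lifting) quat_elem_eq_iff someI)
  have "f v \<le> f u + 1" if "(u, v) \<in> parcs (quat_digraph m)" for u v
  proof -
    have "\<exists>p l. (u, v) = (quat_elem m p, quat_elem m (quat_step m p l)) \<and> l \<in> quat_letters"
      using that unfolding parcs_quat_digraph by (rule CollectD)
    then show ?thesis
    proof (elim exE conjE)
      fix p l
      assume "(u, v) = (quat_elem m p, quat_elem m (quat_step m p l))"
      then have "u = quat_elem m p" "v = quat_elem m (quat_step m p l)"
        by (simp_all only: prod.inject)
      moreover assume "l \<in> quat_letters"
      ultimately show ?thesis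
        using lip[of l p] by (simp only: f)
    qed
  qed
  moreover have "finite (pverts (quat_digraph m))"
    using assms(1) by (simp add: pverts_quat_digraph finite_carrier_quat_group)
  ultimately show ?thesis
    using sum_lipschitz_le_wasserstein[where G = "quat_digraph m" and f = f
      and \<mu> = "lazy_walk (quat_digraph m) \<alpha> (quat_elem m p)"
      and \<nu> = "lazy_walk (quat_digraph m) \<alpha> (quat_elem m q)"]
    by (simp only: sum_lazy_walk_quat_digraph[OF assms(1)] f)
qed

text \<open>The potential takes the value \<open>h (i mod 2m)\<close> at \<open>a\<^sup>i\<close> and \<open>g (i mod m)\<close> at \<open>a\<^sup>i b\<close>. As \<open>a\<^sup>i\<close> and
  \<open>a\<^sup>i\<^sup>+\<^sup>m\<close> have the same neighbours in the coset of \<open>b\<close>, period \<open>m\<close> on that coset is enough.\<close>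

lemma quat_periodic_potential:
  fixes h g :: "int \<Rightarrow> real"
  defines "\<phi> \<equiv> \<lambda>m (i, s). if s then g (i mod int m) else h (i mod (2 * int m))"
  assumes m: "m \<ge> 2"
    and h: "\<And>j. 0 \<le> j \<Longrightarrow> j < 2 * int m \<Longrightarrow> h (if j + 1 = 2 * int m then 0 else j + 1) \<le> h j + 1"
    and g: "\<And>j. 0 \<le> j \<Longrightarrow> j < int m \<Longrightarrow> g (if j = 0 then int m - 1 else j - 1) \<le> g j + 1"
    and hg: "\<And>j. 0 \<le> j \<Longrightarrow> j < 2 * int m \<Longrightarrow> \<bar>h j - g (if j < int m then j else j - int m)\<bar> \<le> 1"
  shows "quat_eq m p q \<Longrightarrow> \<phi> m p = \<phi> m q"
    and "l \<in> quat_letters \<Longrightarrow> \<phi> m (quat_step m p l) \<le> \<phi> m p + 1"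
proof -
  have mod_m: "i mod (2 * int m) mod int m = i mod int m" for i
    by (simp add: mod_mod_cancel)
  show "quat_eq m p q \<Longrightarrow> \<phi> m p = \<phi> m q"
    using mod_m by (cases p; cases q) (auto simp: \<phi>_def quat_eq_def cong_def, metis)
  have h': "h ((i + 1) mod (2 * int m)) \<le> h (i mod (2 * int m)) + 1" for i
  proof -
    have "(i + 1) mod (2 * int m) = (i mod (2 * int m) + 1) mod (2 * int m)"
      by (simp add: mod_simps)
    also have "\<dots> = (if i mod (2 * int m) + 1 = 2 * int m then 0 else i mod (2 * int m) + 1)"
    proof (cases "i mod (2 * int m) + 1 = 2 * int m")
      case False
      moreover have "0 \<le> i mod (2 * int m)" "i mod (2 * int m) < 2 * int m"
        using m by simp_all
      ultimately show ?thesis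
        by (simp add: mod_pos_pos_trivial)
    qed simp
    finally show ?thesis
      using h[of "i mod (2 * int m)"] m by simp
  qed
  \<comment> \<open>On the coset of b, right multiplication by a lowers the exponent.\<close>
  have g': "g ((i - 1) mod int m) \<le> g (i mod int m) + 1" for i
  proof -
    have "(i - 1) mod int m = (i mod int m - 1) mod int m"
      by (simp add: mod_simps)
    also have "\<dots> = (if i mod int m = 0 then int m - 1 else i mod int m - 1)"
    proof (cases "i mod int m = 0")
      case True
      then show ?thesis
        using m by (simp add: zmod_minus1)
    next
      case False
      moreover have "0 \<le> i mod int m" "i mod int m < int m"
        using m by simp_all
      ultimately show ?thesis
        by (simp add: mod_pos_pos_trivial)
    qed
    finally show ?thesis
      using g[of "i mod int m"] m by simp
  qed
  have hg': "\<bar>h (i mod (2 * int m)) - g (i mod int m)\<bar> \<le> 1" for i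
  proof -
    let ?j = "i mod (2 * int m)"
    have j: "0 \<le> ?j" "?j < 2 * int m"
      using m by simp_all
    have "?j mod int m = (if ?j < int m then ?j else ?j - int m)"
    proof (cases "?j < int m")
      case False
      then have "?j mod int m = (?j - int m) mod int m"
        by simp
      also have "\<dots> = ?j - int m"
        using False j by (intro mod_pos_pos_trivial) auto
      finally show ?thesis
        using False by simp
    qed (use j in simp)
    then show ?thesis
      using hg[OF j] mod_m[of i] by simp
  qed
  \<comment> \<open>Arcs labelled b or b^-1 change the coset and shift the exponent by 0, m or -m.
    They run in both directions between the cosets, which is why \<open>hg\<close> bounds an
    absolute value.\<close>
  have "g ((i + int m) mod int m) = g (i mod int m)" "g ((i - int m) mod int m) = g (i mod int m)" for i
    by simp_all
  then show "\<phi> m (quat_step m p l) \<le> \<phi> m p + 1" if "l \<in> quat_letters"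
    using that h'[of "fst p"] g'[of "fst p"] hg'[of "fst p"] hg'[of "fst p + int m"]
      hg'[of "fst p - int m"]
    by (cases p) (auto simp: \<phi>_def)
qed


text \<open>The values are those of the potential at the out-neighbours: a, b, b^-1 for e; a^2, a b,
  a b^-1 for a; b a = a^-1 b, b^2 = a^m and e for b. By periodicity \<open>g\<close> agrees at b and
  b^-1, and at a b and a b^-1.\<close>

lemma quat_wasserstein_ge:
  fixes h g :: "int \<Rightarrow> real"
  assumes m: "m \<ge> 2"
    and h: "\<And>j. 0 \<le> j \<Longrightarrow> j < 2 * int m \<Longrightarrow> h (if j + 1 = 2 * int m then 0 else j + 1) \<le> h j + 1"
    and g: "\<And>j. 0 \<le> j \<Longrightarrow> j < int m \<Longrightarrow> g (if j = 0 then int m - 1 else j - 1) \<le> g j + 1"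
    and hg: "\<And>j. 0 \<le> j \<Longrightarrow> j < 2 * int m \<Longrightarrow> \<bar>h j - g (if j < int m then j else j - int m)\<bar> \<le> 1"
  defines "\<Gamma> \<equiv> quat_digraph m" and "e \<equiv> quat_elem m (0, False)"
    and "a \<equiv> quat_elem m (1, False)" and "b \<equiv> quat_elem m (0, True)"
  shows "ennreal ((\<alpha> * h 1 + (1 - \<alpha>) / 3 * (h 2 + 2 * g 1)) - (\<alpha> * h 0 + (1 - \<alpha>) / 3 * (h 1 + 2 * g 0)))
      \<le> wasserstein \<Gamma> (lazy_walk \<Gamma> \<alpha> e) (lazy_walk \<Gamma> \<alpha> a)"
    and "ennreal ((\<alpha> * g 0 + (1 - \<alpha>) / 3 * (h 0 + h (int m) + g (int m - 1)))
        - (\<alpha> * h 0 + (1 - \<alpha>) / 3 * (h 1 + 2 * g 0)))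
      \<le> wasserstein \<Gamma> (lazy_walk \<Gamma> \<alpha> e) (lazy_walk \<Gamma> \<alpha> b)"
proof -
  define \<phi> where "\<phi> = (\<lambda>(i, s). if s then g (i mod int m) else h (i mod (2 * int m)))"
  have eq: "\<phi> p = \<phi> q" if "quat_eq m p q" for p q
    using quat_periodic_potential(1)[OF m h g hg that] by (simp add: \<phi>_def)
  have lip: "\<phi> (quat_step m p l) \<le> \<phi> p + 1" if "l \<in> quat_letters" for p l
    using quat_periodic_potential(2)[OF m h g hg that] by (simp add: \<phi>_def)
  note le = quat_potential_le_wasserstein[OF m eq lip, of \<alpha>]
  have "\<phi> (0, False) = h 0" "\<phi> (1, False) = h 1" "\<phi> (2, False) = h 2" "\<phi> (int m, False) = h (int m)"
    "\<phi> (0, True) = g 0" "\<phi> (- int m, True) = g 0" "\<phi> (1, True) = g 1" "\<phi> (- 1, True) = g (int m - 1)"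
    using m by (auto simp: \<phi>_def zmod_minus1)
  moreover have "\<phi> (1 - int m, True) = g 1"
  proof -
    have "(1 - int m) mod int m = 1 mod int m"
      by (simp add: mod_simps)
    then show ?thesis
      using m by (simp add: \<phi>_def)
  qed
  ultimately show "ennreal ((\<alpha> * h 1 + (1 - \<alpha>) / 3 * (h 2 + 2 * g 1)) - (\<alpha> * h 0 + (1 - \<alpha>) / 3 * (h 1 + 2 * g 0)))
      \<le> wasserstein \<Gamma> (lazy_walk \<Gamma> \<alpha> e) (lazy_walk \<Gamma> \<alpha> a)"
    and "ennreal ((\<alpha> * g 0 + (1 - \<alpha>) / 3 * (h 0 + h (int m) + g (int m - 1)))
        - (\<alpha> * h 0 + (1 - \<alpha>) / 3 * (h 1 + 2 * g 0)))
      \<le> wasserstein \<Gamma> (lazy_walk \<Gamma> \<alpha> e) (lazy_walk \<Gamma> \<alpha> b)"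
    using le[of "(1, False)" "(0, False)"] le[of "(0, True)" "(0, False)"]
    by (simp_all add: \<Gamma>_def e_def a_def b_def algebra_simps)
qed

text \<open>\<open>D\<close> is the distance from \<open>b\<close> to \<open>a b\<^sup>-\<^sup>1\<close>, from \<open>b\<^sup>-\<^sup>1\<close> to \<open>a b\<close> and from \<open>a\<close> to \<open>b a\<close>.\<close>

lemma quat_wasserstein_ge_explicit:
  assumes m: "m \<ge> 2" and "0 < \<alpha>" "\<alpha> < 1"
  defines "\<Gamma> \<equiv> quat_digraph m" and "e \<equiv> quat_elem m (0, False)"
    and "a \<equiv> quat_elem m (1, False)" and "b \<equiv> quat_elem m (0, True)"
    and "D \<equiv> real (min (m - 1) 3)"
  shows "ennreal (1 - (2 / 3 - 2 * D / 3) * (1 - \<alpha>))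
        \<le> wasserstein \<Gamma> (lazy_walk \<Gamma> \<alpha> e) (lazy_walk \<Gamma> \<alpha> a)"
    and "ennreal (1 - (1 - D / 3) * (1 - \<alpha>))
          \<le> wasserstein \<Gamma> (lazy_walk \<Gamma> \<alpha> e) (lazy_walk \<Gamma> \<alpha> b)"
proof -
  \<comment> \<open>Complementary slackness dictates the potentials: every pair in the plan must be
    tight. For (e,a) this means h 1 = h 0 + 1, h 2 = h 1 + 1, g 1 = g 0 + D; for (e,b) it means g 0
    = h 0 + 1, h m = g 0 + 1, g (m - 1) = h 1 + D. The other values are filled in within the
    Lipschitz bounds.\<close>
  consider "m = 2" | "m = 3" | "m \<ge> 4"
    using m by linarith
  then have "ennreal (1 - (2 / 3 - 2 * D / 3) * (1 - \<alpha>))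
        \<le> wasserstein \<Gamma> (lazy_walk \<Gamma> \<alpha> e) (lazy_walk \<Gamma> \<alpha> a)
    \<and> ennreal (1 - (1 - D / 3) * (1 - \<alpha>))
          \<le> wasserstein \<Gamma> (lazy_walk \<Gamma> \<alpha> e) (lazy_walk \<Gamma> \<alpha> b)"
  proof cases
    case 1
    \<comment> \<open>For D = 1 both systems are compatible, and one potential serves both
      arcs.\<close>
    let ?h = "\<lambda>j::int. if j = 0 then 0 else if j = 2 then 2 else 1 :: real"
    let ?g = "\<lambda>j::int. if j = 0 then 1 else 2 :: real"
    show ?thesis
      unfolding \<Gamma>_def e_def a_def b_def
      by (intro conjI order_trans[OF eq_refl[OF arg_cong[where f = ennreal]]
        quat_wasserstein_ge(1)[where h = ?h and g = ?g]]
        order_trans[OF eq_refl[OF arg_cong[where f = ennreal]]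
        quat_wasserstein_ge(2)[where h = ?h and g = ?g]])
        (use 1 in \<open>auto simp: D_def field_simps\<close>)
  next
    case 2
    \<comment> \<open>For D \<ge> 2 the systems clash: together they give g 1 - h 1 = D > 1. So each
      arc has its own potential.\<close>
    let ?h = "\<lambda>j::int. if j = 0 \<or> j = 3 then 0 else if j = 1 \<or> j = 4 then 1 else 2 :: real"
    let ?g = "\<lambda>j::int. if j = 0 then 0 else if j = 1 then 2 else 1 :: real"
    let ?h' = "\<lambda>j::int. if j = 3 then 2 else if j = 2 \<or> j = 5 then 1 else 0 :: real"
    let ?g' = "\<lambda>j::int. if j = 2 then 2 else 1 :: real"
    show ?thesis
      unfolding \<Gamma>_def e_def a_def b_def
      by (intro conjI order_trans[OF eq_refl[OF arg_cong[where f = ennreal]]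
        quat_wasserstein_ge(1)[where h = ?h and g = ?g]]
        order_trans[OF eq_refl[OF arg_cong[where f = ennreal]]
        quat_wasserstein_ge(2)[where h = ?h' and g = ?g']])
        (use 2 in \<open>auto simp: D_def field_simps\<close>)
  next
    case 3
    \<comment> \<open>Along exponents 0, m - 1, ..., 3, 2, 1 the values of \<open>?g\<close> are -1,
      0, ..., 0, 1, 2; a climb by 3 in unit steps has room because m - 1 \<ge> 3.\<close>
    let ?h = "\<lambda>j. if j = 1 \<or> j = int m + 1 then 1 else if j = 2 \<or> j = int m + 2 then 2 else 0 :: real"
    let ?g = "\<lambda>j::int. if j = 0 then - 1 else if j = 1 then 2 else if j = 2 then 1 else 0 :: real"
    \<comment> \<open>The drop to -1 at a makes the gap to b a equal to 3; from there
      \<open>?h'\<close> climbs to 2 at a^m. The value 1 at exponent 2m - 1 is forced up by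
      \<open>?g'\<close> being 2 at m - 1.\<close>
    let ?h' = "\<lambda>j. if j = 1 then - 1 else if j = int m then 2
      else if 3 \<le> j \<and> j < int m \<or> j = 2 * int m - 1 then 1 else 0 :: real"
    let ?g' = "\<lambda>j. if j = 0 then 1 else if j = int m - 1 then 2 else 0 :: real"
    show ?thesis
      unfolding \<Gamma>_def e_def a_def b_def
      by (intro conjI order_trans[OF eq_refl[OF arg_cong[where f = ennreal]]
        quat_wasserstein_ge(1)[where h = ?h and g = ?g]]
        order_trans[OF eq_refl[OF arg_cong[where f = ennreal]]
        quat_wasserstein_ge(2)[where h = ?h' and g = ?g']])
        (use 3 in \<open>auto simp: D_def field_simps\<close>)
  qed
  then show "ennreal (1 - (2 / 3 - 2 * D / 3) * (1 - \<alpha>))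
        \<le> wasserstein \<Gamma> (lazy_walk \<Gamma> \<alpha> e) (lazy_walk \<Gamma> \<alpha> a)"
    and "ennreal (1 - (1 - D / 3) * (1 - \<alpha>))
          \<le> wasserstein \<Gamma> (lazy_walk \<Gamma> \<alpha> e) (lazy_walk \<Gamma> \<alpha> b)"
    by blast+
qed

section \<open>Upper bounds from transport plans\<close>

lemma quat_wasserstein_le:
  assumes m: "m \<ge> 2" and \<alpha>: "1 / 4 < \<alpha>" "\<alpha> < 1"
  defines "\<Gamma> \<equiv> quat_digraph m" and "e \<equiv> quat_elem m (0, False)"
    and "a \<equiv> quat_elem m (1, False)" and "b \<equiv> quat_elem m (0, True)"
    and "D \<equiv> min (m - 1) 3"
  shows "wasserstein \<Gamma> (lazy_walk \<Gamma> \<alpha> e) (lazy_walk \<Gamma> \<alpha> a)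
        \<le> ennreal (1 - (2 / 3 - 2 * real D / 3) * (1 - \<alpha>))"
    and "wasserstein \<Gamma> (lazy_walk \<Gamma> \<alpha> e) (lazy_walk \<Gamma> \<alpha> b)
          \<le> ennreal (1 - (1 - real D / 3) * (1 - \<alpha>))"
proof -
  let ?E = "quat_elem m" and ?\<epsilon> = "(1 - \<alpha>) / 3"
  let ?a = "(A, True)" and ?b = "(B, True)" and ?b' = "(B, False)"
  have dist: "digraph_dist \<Gamma> (?E p) (?E q) \<le> enat n"
    if "set w \<subseteq> quat_letters" "quat_eq m (foldl (quat_step m) p w) q" "length w = n" for p q w n
    using digraph_dist_quat_le[OF that(1,2)] that(3) by (simp add: \<Gamma>_def)
  have vert: "?E p \<in> pverts \<Gamma>" for p
    by (simp add: \<Gamma>_def pverts_quat_digraph)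
  have fin: "finite (pverts \<Gamma>)"
    using m by (simp add: \<Gamma>_def pverts_quat_digraph finite_carrier_quat_group)
  have move_a: "digraph_dist \<Gamma> (?E (i, False)) (?E (i + 1, False)) \<le> enat 1" for i
    by (rule dist[of "[?a]"]) simp_all
  have move_b: "digraph_dist \<Gamma> (?E (i, False)) (?E (i, True)) \<le> enat 1" for i
    by (rule dist[of "[?b]"]) simp_all
  \<comment> \<open>The arc ends at a^-m, which is a^m.\<close>
  have move_b': "digraph_dist \<Gamma> (?E (- int m, True)) (?E (int m, False)) \<le> enat 1"
    by (rule dist[of "[?b']"]) (simp_all add: quat_eq_def cong_iff_dvd_diff)
  have stay: "digraph_dist \<Gamma> (?E p) (?E p) \<le> enat 0" for p
    by (rule dist[of "[]"]) simp_all
  consider "m = 2" | "m = 3" | "m \<ge> 4"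
    using m by linarith
  then have D: "digraph_dist \<Gamma> (?E (0, True)) (?E (1 - int m, True)) \<le> enat D \<and>
    digraph_dist \<Gamma> (?E (- int m, True)) (?E (1, True)) \<le> enat D \<and>
    digraph_dist \<Gamma> (?E (1, False)) (?E (- 1, True)) \<le> enat D"
  proof cases
    case 1
    then show ?thesis
      by (intro conjI dist[of "[?a]"] dist[of "[?b']"])
        (simp_all add: D_def quat_eq_def cong_iff_dvd_diff)
  next
    case 2
    then show ?thesis
      by (intro conjI dist[of "[?a, ?a]"] dist[of "[?a, ?b']"])
        (simp_all add: D_def quat_eq_def cong_iff_dvd_diff)
  next
    case 3
    then show ?thesis
      by (intro conjI dist[of "[?b, ?a, ?b]"] dist[of "[?b', ?a, ?b']"] dist[of "[?b, ?a, ?a]"])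
        (simp_all add: D_def quat_eq_def cong_iff_dvd_diff)
  qed
  note walk = lazy_walk_quat_digraph[OF m, folded \<Gamma>_def]
  \<comment> \<open>The portions at b and b^-1 go crosswise: the displacement a^(m-1) has length 1
    or 2 for m = 2 or 3, whereas b to a b would be the displacement a^-1.\<close>
  let ?P = "[(e, a, \<alpha>, 1), (a, ?E (2, False), ?\<epsilon>, 1),
    (b, ?E (1 - int m, True), ?\<epsilon>, D), (?E (- int m, True), ?E (1, True), ?\<epsilon>, D)]"
  have "wasserstein \<Gamma> (lazy_walk \<Gamma> \<alpha> e) (lazy_walk \<Gamma> \<alpha> a)
        \<le> ennreal (\<Sum>(u, v, w, n)\<leftarrow>?P. w * real n)"
  proof (rule wasserstein_le_plan[OF fin])
    show "u \<in> pverts \<Gamma> \<and> v \<in> pverts \<Gamma> \<and> 0 \<le> w \<and> digraph_dist \<Gamma> u v \<le> enat n"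
      if "(u, v, w, n) \<in> set ?P" for u v w n
      using that \<alpha> vert D move_a[of 0] move_a[of 1] by (auto simp: e_def a_def b_def)
    show "(\<Sum>(u, v, w, n)\<leftarrow>?P. w) \<le> 1"
      by (simp add: field_simps)
  qed (simp_all add: e_def a_def b_def walk)
  also have "(\<Sum>(u, v, w, n)\<leftarrow>?P. w * real n) = 1 - (2 / 3 - 2 * real D / 3) * (1 - \<alpha>)"
    by (simp add: field_simps)
  finally show "wasserstein \<Gamma> (lazy_walk \<Gamma> \<alpha> e) (lazy_walk \<Gamma> \<alpha> a)
        \<le> ennreal (1 - (2 / 3 - 2 * real D / 3) * (1 - \<alpha>))" .
  \<comment> \<open>Since e is a neighbour of b and b one of e, both measures share mass
    \<open>?\<epsilon>\<close> at e and at b, which stays. Thus e sends only \<alpha> -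
    \<open>?\<epsilon>\<close>, nonnegative by 1/4 < \<alpha>.\<close>
  let ?P = "[(e, b, \<alpha> - ?\<epsilon>, 1), (e, e, ?\<epsilon>, 0), (b, b, ?\<epsilon>, 0),
    (a, ?E (- 1, True), ?\<epsilon>, D), (?E (- int m, True), ?E (int m, False), ?\<epsilon>, 1)]"
  have "wasserstein \<Gamma> (lazy_walk \<Gamma> \<alpha> e) (lazy_walk \<Gamma> \<alpha> b)
        \<le> ennreal (\<Sum>(u, v, w, n)\<leftarrow>?P. w * real n)"
  proof (rule wasserstein_le_plan[OF fin])
    show "u \<in> pverts \<Gamma> \<and> v \<in> pverts \<Gamma> \<and> 0 \<le> w \<and> digraph_dist \<Gamma> u v \<le> enat n"
      if "(u, v, w, n) \<in> set ?P" for u v w n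
      using that \<alpha> vert D move_b[of 0] move_b' stay by (auto simp: e_def a_def b_def)
    show "(\<Sum>(u, v, w, n)\<leftarrow>?P. w) \<le> 1"
      by (simp add: field_simps)
  qed (simp_all add: e_def a_def b_def walk algebra_simps)
  also have "(\<Sum>(u, v, w, n)\<leftarrow>?P. w * real n) = 1 - (1 - real D / 3) * (1 - \<alpha>)"
    by (simp add: field_simps)
  finally show "wasserstein \<Gamma> (lazy_walk \<Gamma> \<alpha> e) (lazy_walk \<Gamma> \<alpha> b)
        \<le> ennreal (1 - (1 - real D / 3) * (1 - \<alpha>))" .
qed

theorem proposition4p4:
  fixes m :: nat
  assumes "m \<ge> 2"
  shows "let Q = quat_group m; a = quat_a m; b = quat_b m;
             \<Gamma> = cayley_digraph Q {a, b, inv\<^bsub>Q\<^esub> b}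
         in has_LLY_curvature \<Gamma> \<one>\<^bsub>Q\<^esub> a
              (if m = 2 then 0 else if m = 3 then - (2 / 3) else - (4 / 3))
          \<and> has_LLY_curvature \<Gamma> \<one>\<^bsub>Q\<^esub> b
              (if m = 2 then 2 / 3 else if m = 3 then 1 / 3 else 0)"
proof -
  let ?\<Gamma> = "quat_digraph m" and ?E = "quat_elem m" and ?D = "real (min (m - 1) 3)"
  have gens: "\<one>\<^bsub>quat_group m\<^esub> = ?E (0, False)" "quat_a m = ?E (1, False)" "quat_b m = ?E (0, True)"
    by (simp_all add: quat_elem_0 quat_a_def quat_b_def quat_class_eq_quat_elem)
  have "\<not> 2 * int m dvd 1"
    using assms by (auto dest: zdvd_imp_le)
  then have neq: "?E (0, False) \<noteq> ?E (1, False)" "?E (0, False) \<noteq> ?E (0, True)"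
    by (simp_all add: quat_elem_eq_iff quat_eq_def cong_iff_dvd_diff)
  have "(?E (0, False), ?E (quat_step m (0, False) l)) \<in> parcs ?\<Gamma>" if "l \<in> quat_letters" for l
    using that unfolding parcs_quat_digraph by blast
  from this[of "(A, True)"] this[of "(B, True)"]
  have dist: "digraph_dist ?\<Gamma> (?E (0, False)) (?E (1, False)) = 1"
    "digraph_dist ?\<Gamma> (?E (0, False)) (?E (0, True)) = 1"
    using neq by (simp_all add: digraph_dist_arc pverts_quat_digraph)
  have "has_LLY_curvature ?\<Gamma> (?E (0, False)) (?E (1, False)) (2 / 3 - 2 * ?D / 3)"
    by (rule has_LLY_curvatureI[where c = "1 / 4", OF dist(1) _ _
          antisym[OF quat_wasserstein_le(1)[OF assms] quat_wasserstein_ge_explicit(1)[OF assms]]])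
      (use assms in simp_all)
  moreover have "has_LLY_curvature ?\<Gamma> (?E (0, False)) (?E (0, True)) (1 - ?D / 3)"
    by (rule has_LLY_curvatureI[where c = "1 / 4", OF dist(2) _ _
          antisym[OF quat_wasserstein_le(2)[OF assms] quat_wasserstein_ge_explicit(2)[OF assms]]])
      (use assms in simp_all)
  moreover have "min (m - 1) 3 = (if m = 2 then 1 else if m = 3 then 2 else 3)"
    using assms by (auto simp: min_def)
  then have "2 / 3 - 2 * ?D / 3 = (if m = 2 then 0 else if m = 3 then - (2 / 3) else - (4 / 3))"
    "1 - ?D / 3 = (if m = 2 then 2 / 3 else if m = 3 then 1 / 3 else 0)"
    by simp_all
  ultimately show ?thesis
    by (simp add: Let_def quat_digraph_def gens)
qed

end
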